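(* Let $(\mathcal S,\mathcal A,\mu)$ be a $\sigma$-finite measure space, $p(s)\ge0$ with $\int_{\mathcal S}p\,d\mu=1$, and $P(A)=\int_Ap\,d\mu$. Let $(T,\rho)$ be a compact metric space with a $\sigma$-finite measure $\nu$, and let $f(s,t)$ be jointly measurable in $(s,t)$ and continuous in $t$, such that $I(t)=\int_{\mathcal S}f(s,t)p(s)\,d\mu(s)$ exists for every $t\in T$. Regard $\xi(t)=f(s,t)$ as a random process on $(\mathcal S,\mathcal A,P)$, so $I(t)=E\xi(t)$. Suppose $\xi(t)$ belongs to the space $\mathbf F_\psi(\Omega)$, for which condition $\mathbf H$ with constant $C_\psi$ is satisfied. Let $\xi_i(t)$ be independent copies of $\xi(t)$, $Z_n(t)=\frac1n\sum_{i=1}^n\xi_i(t)$ and $\widetilde Z_n(t)=\frac1n\sum_{i=1}^n(\xi_i(t)-I(t))$. Then for all $p\ge1$ $$\left\|\left(\int_T|\widetilde Z_n(t)|^p\,d\nu(t)\right)^{1/p}\right\|_\psi\le\frac{2\sqrt{C_\psi}}{\sqrt n}\cdot\frac{\psi(p)}{\psi(1)}\left(\int_T\|\xi(t)\|_\psi^p\,d\nu(t)\right)^{1/p},$$ and $Z_n(t)$ approximates $I(t)$ with reliability $1-\delta$ and accuracy $\varepsilon$ in the space $L_p(T)$, i.e. $P\big\{\big(\int_T|Z_n(t)-I(t)|^p\,d\nu(t)\big)^{1/p}>\varepsilon\big\}\le\delta$, for $n$ such that $$\inf_{u\ge1}\frac{\left(\frac{2\sqrt{C_\psi}}{\sqrt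 n}\cdot\frac{\psi(p)}{\psi(1)}\right)^u\left(\int_T\|\xi(t)\|_\psi^p\,d\nu(t)\right)^{u/p}(\psi(u))^u}{\varepsilon^u}\le\delta.$$
   Context: $\psi(u)>0$, $u\ge1$, is a monotonically increasing continuous function with $\psi(u)\to\infty$ as $u\to\infty$. $\mathbf F_\psi(\Omega)$ is the Banach space of random variables with norm $\|\xi\|_\psi=\sup_{u\ge1}\frac{(E|\xi|^u)^{1/u}}{\psi(u)}<\infty$; a process belongs to it if each of its values does. Condition $\mathbf H$ with constant $C_\psi$: for any centered independent $\xi_1,\dots,\xi_n$ from the space, $\|\sum_{i=1}^n\xi_i\|_\psi^2\le C_\psi\sum_{i=1}^n\|\xi_i\|_\psi^2$. The exponent $p\ge1$ is unrelated to the density $p(s)$. Independent copies are of the form $\xi_i(t)=f(s_i,t)$ with $s_i$ independent with law $P$. *)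

theory Defs
  imports "HOL-Probability.Probability"
begin

text \<open>
  Real powers on \<^typ>\<open>ennreal\<close>, used only for exponents \<open>a > 0\<close>, where
  \<open>0\<close> is sent to \<open>0\<close> and \<open>\<infinity>\<close> to \<open>\<infinity>\<close>.
\<close>

definition epowr :: "ennreal \<Rightarrow> real \<Rightarrow> ennreal" (infixr "epowr" 80) where
  "x epowr a = (if x = \<infinity> then \<infinity> else ennreal (enn2real x powr a))"

definition psi_function :: "(real \<Rightarrow> real) \<Rightarrow> bool" where
  "psi_function \<psi> \<longleftrightarrow>
     (\<forall>u\<ge>1. 0 < \<psi> u) \<and> mono_on {1..} \<psi> \<and> continuous_on {1..} \<psi> \<and> filterlim \<psi> at_top at_top"

text \<open>
  The norm \<open>\<parallel>\<xi>\<parallel>\<^sub>\<psi>\<close>, first for a nonnegative variable that may take the value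
  \<open>\<infinity>\<close> (such as a norm of a random function), then for a real-valued one. Both take values in
  \<open>[0, \<infinity>]\<close>; membership in the space is finiteness. As usual for \<open>L\<^sub>p\<close>-type spaces in
  HOL, variables that agree almost surely are not identified.
\<close>

definition psi_enorm :: "'w measure \<Rightarrow> (real \<Rightarrow> real) \<Rightarrow> ('w \<Rightarrow> ennreal) \<Rightarrow> ennreal" where
  "psi_enorm M \<psi> X =
     (SUP u\<in>{1..}. (\<integral>\<^sup>+ \<omega>. X \<omega> epowr u \<partial>M) epowr (1 / u) / ennreal (\<psi> u))"

definition psi_norm :: "'w measure \<Rightarrow> (real \<Rightarrow> real) \<Rightarrow> ('w \<Rightarrow> real) \<Rightarrow> ennreal" where
  "psi_norm M \<psi> X = psi_enorm M \<psi> (\<lambda>\<omega>. ennreal \<bar>X \<omega>\<bar>)"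

definition psi_space :: "'w measure \<Rightarrow> (real \<Rightarrow> real) \<Rightarrow> ('w \<Rightarrow> real) set" where
  "psi_space M \<psi> = {X \<in> borel_measurable M. psi_norm M \<psi> X < \<infinity>}"

definition condition_H :: "'w measure \<Rightarrow> (real \<Rightarrow> real) \<Rightarrow> real \<Rightarrow> bool" where
  "condition_H M \<psi> C \<longleftrightarrow>
     (\<forall>(n::nat) (X :: nat \<Rightarrow> 'w \<Rightarrow> real).
        (\<forall>i\<in>{1..n}. X i \<in> psi_space M \<psi> \<and> prob_space.expectation M (X i) = 0) \<and>
        prob_space.indep_vars M (\<lambda>_. borel) X {1..n} \<longrightarrow>
        (psi_norm M \<psi> (\<lambda>\<omega>. \<Sum>i=1..n. X i \<omega>))\<^sup>2 \<le>
          ennreal C * (\<Sum>i=1..n. (psi_norm M \<psi> (X i))\<^sup>2))"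

definition Lp_enorm :: "'t measure \<Rightarrow> real \<Rightarrow> ('t \<Rightarrow> ennreal) \<Rightarrow> ennreal" where
  "Lp_enorm \<nu> p h = (\<integral>\<^sup>+ t. h t epowr p \<partial>\<nu>) epowr (1 / p)"

text \<open>The process \<open>Z\<close> approximates the function \<open>I\<close> with reliability
  \<open>1 - \<delta>\<close> and accuracy \<open>\<epsilon>\<close> in the space \<open>L\<^sub>p\<close>.\<close>

definition approximates_in_Lp ::
    "'w measure \<Rightarrow> 't measure \<Rightarrow> real \<Rightarrow> ('w \<Rightarrow> 't \<Rightarrow> real) \<Rightarrow> ('t \<Rightarrow> real) \<Rightarrow> real \<Rightarrow> real \<Rightarrow> bool" where
  "approximates_in_Lp M \<nu> p Z I \<delta> \<epsilon> \<longleftrightarrow>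
     measure M {\<omega> \<in> space M. Lp_enorm \<nu> p (\<lambda>t. ennreal \<bar>Z \<omega> t - I t\<bar>) > ennreal \<epsilon>} \<le> \<delta>"

end

theory Submission
  imports Defs
begin

text \<open>
  Fix \<open>t\<close>. The centred mean \<open>Z\<^sub>n(t) - I(t)\<close> is a sum of the \<open>n\<close> independent centred variables
  \<open>(\<xi>\<^sub>i(t) - I(t)) / n\<close>. Centring at most doubles the norm, so condition \<open>H\<close> yields
  \<open>\<parallel>Z\<^sub>n(t) - I(t)\<parallel>\<^sub>\<psi> \<le> (2 \<surd>C / \<surd>n) \<parallel>\<xi>(t)\<parallel>\<^sub>\<psi>\<close>
  (\<open>psi_norm_centered_mean\<close>).

  These bounds for single points \<open>t\<close> are combined by Minkowski's integral inequality
  (\<open>Minkowski_integral\<close>). For \<open>v \<ge> p\<close> it says that the \<open>L\<^sub>v\<close> norm over \<open>\<omega>\<close> of the \<open>L\<^sub>p\<close> norm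
  over \<open>t\<close> is at most the \<open>L\<^sub>p\<close> norm over \<open>t\<close> of the \<open>L\<^sub>v\<close> norm over \<open>\<omega>\<close>
  (\<open>Lp_enorm_swap\<close>), and the latter is at most \<open>\<psi>(v)\<close> times the \<open>L\<^sub>p\<close> norm of the pointwise
  bound. Moments of order \<open>u < p\<close> are first dominated by the moment of order \<open>p\<close>, which costs the factor
  \<open>\<psi>(p) / \<psi>(1)\<close> (\<open>psi_enorm_Lp_enorm_le\<close>).

  The reliability statement is Markov's inequality for the \<open>u\<close>-th moment of the \<open>L\<^sub>p\<close> error,
  optimised over \<open>u\<close> (\<open>psi_enorm_tail_bound\<close>).
\<close>

section \<open>Powers of extended nonnegative numbers\<close>

lemma epowr_one [simp]: "x epowr 1 = x"
  by (cases x) (auto simp: epowr_def)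

lemma epowr_mult: "(x * y) epowr a = x epowr a * y epowr a"
  by (cases x; cases y)
    (auto simp: epowr_def ennreal_mult_eq_top_iff ennreal_top_mult ennreal_mult_top powr_mult enn2real_mult ennreal_mult)

lemma epowr_epowr: "(x epowr a) epowr b = x epowr (a * b)"
  by (cases x) (auto simp: epowr_def powr_powr)

lemma epowr_add: "x epowr (a + b) = x epowr a * x epowr b"
  by (cases x) (auto simp: epowr_def powr_add ennreal_mult)

lemma epowr_mono: "x \<le> y \<Longrightarrow> 0 \<le> a \<Longrightarrow> x epowr a \<le> y epowr a"
  by (cases x; cases y) (auto simp: epowr_def powr_mono2 top_unique intro!: ennreal_leI)

lemma epowr_ennreal: "0 \<le> x \<Longrightarrow> ennreal x epowr a = ennreal (x powr a)"
  by (simp add: epowr_def)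

lemma epowr_eq_0_iff [simp]: "x epowr a = 0 \<longleftrightarrow> x = 0"
  by (cases x) (auto simp: epowr_def ennreal_eq_0_iff)

lemma epowr_eq_top_iff [simp]: "x epowr a = \<top> \<longleftrightarrow> x = \<top>"
  by (cases x) (auto simp: epowr_def)

lemma measurable_epowr [measurable (raw)]:
  "f \<in> borel_measurable M \<Longrightarrow> (\<lambda>x. f x epowr a) \<in> borel_measurable M"
  unfolding epowr_def by (measurable, simp_all)

lemma epowr_two: "x epowr 2 = x\<^sup>2"
  by (cases x) (auto simp: epowr_def powr_numeral ennreal_power)

text \<open>For \<open>a > 0\<close> the power is an order isomorphism of \<open>[0, \<infinity>]\<close> with inverse the power
  \<open>1 / a\<close>, and so it preserves suprema.\<close>

lemma SUP_epowr:
  assumes "0 < a" shows "(SUP i\<in>A. F i) epowr a = (SUP i\<in>A. F i epowr a)"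
proof (rule antisym)
  have "(SUP i\<in>A. F i) \<le> (SUP i\<in>A. F i epowr a) epowr (1/a)"
  proof (rule SUP_least)
    fix i assume "i \<in> A"
    hence "(F i epowr a) epowr (1/a) \<le> (SUP i\<in>A. F i epowr a) epowr (1/a)"
      using assms by (intro epowr_mono SUP_upper) auto
    thus "F i \<le> (SUP i\<in>A. F i epowr a) epowr (1/a)" using assms by (simp add: epowr_epowr)
  qed
  hence "(SUP i\<in>A. F i) epowr a \<le> ((SUP i\<in>A. F i epowr a) epowr (1/a)) epowr a"
    using assms by (intro epowr_mono) auto
  thus "(SUP i\<in>A. F i) epowr a \<le> (SUP i\<in>A. F i epowr a)" using assms by (simp add: epowr_epowr)
qed (use assms in \<open>auto intro!: SUP_least epowr_mono SUP_upper\<close>)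

section \<open>The inequalities of Hoelder and Minkowski\<close>

lemma Young_ennreal:
  assumes "1 < p" "1 < q" "1 / p + 1 / q = 1"
  shows "x * y \<le> ennreal (1 / p) * x epowr p + ennreal (1 / q) * y epowr q"
proof (cases "x = \<infinity> \<or> y = \<infinity>")
  case True
  thus ?thesis using assms by (auto simp: ennreal_mult_top epowr_def)
next
  case False
  then obtain a b where ab: "x = ennreal a" "0 \<le> a" "y = ennreal b" "0 \<le> b"
    by (metis ennreal_cases infinity_ennreal_def)
  have "a * b \<le> 1 / p * a powr p + 1 / q * b powr q"
    using Youngs_inequality[of p q a b] assms ab by simp
  thus ?thesis using ab assms
    by (simp add: epowr_ennreal flip: ennreal_mult ennreal_plus) 
qed

lemma Lp_enorm_epowr: "p \<noteq> 0 \<Longrightarrow> Lp_enorm M p f epowr p = (\<integral>\<^sup>+ x. f x epowr p \<partial>M)"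
  by (simp add: Lp_enorm_def epowr_epowr)

text \<open>The factor \<open>c\<close> may be \<open>0\<close> or \<open>\<infinity>\<close>, since \<open>0 \<cdot> \<infinity> = 0\<close> makes powers
  multiplicative without exception.\<close>

lemma Lp_enorm_cmult:
  assumes [measurable]: "f \<in> borel_measurable M" and "0 < p"
  shows "Lp_enorm M p (\<lambda>x. c * f x) = c * Lp_enorm M p f"
  using assms(2) by (simp add: Lp_enorm_def epowr_mult nn_integral_cmult epowr_epowr)

lemma Lp_enorm_mono:
  assumes "0 \<le> p" "\<And>x. x \<in> space M \<Longrightarrow> f x \<le> g x"
  shows "Lp_enorm M p f \<le> Lp_enorm M p g"
  unfolding Lp_enorm_def using assms by (intro epowr_mono nn_integral_mono) auto

lemma Lp_enorm_eq_0_iff: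
  assumes [measurable]: "f \<in> borel_measurable M"
  shows "Lp_enorm M p f = 0 \<longleftrightarrow> (AE x in M. f x = 0)"
  by (simp add: Lp_enorm_def nn_integral_0_iff_AE)

text \<open>After both factors have been normalised to norm 1, integrating Young's inequality bounds the
  integral of the product by \<open>1 / p + 1 / q = 1\<close>.\<close>

lemma Hoelder:
  assumes [measurable]: "f \<in> borel_measurable M" "g \<in> borel_measurable M"
    and pq: "1 < p" "1 < q" "1 / p + 1 / q = 1"
  shows "(\<integral>\<^sup>+ x. f x * g x \<partial>M) \<le> Lp_enorm M p f * Lp_enorm M q g"
proof -
  define a b where "a = Lp_enorm M p f" and "b = Lp_enorm M q g"
  consider "a = 0" | "b = 0" | "a \<noteq> 0" "b \<noteq> 0" "a = \<infinity> \<or> b = \<infinity>"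
    | "a \<noteq> 0" "b \<noteq> 0" "a \<noteq> \<infinity>" "b \<noteq> \<infinity>" by blast
  thus ?thesis
  proof cases
    case 1
    hence "AE x in M. f x * g x = 0" by (auto simp: a_def Lp_enorm_eq_0_iff)
    hence "(\<integral>\<^sup>+ x. f x * g x \<partial>M) = 0" by (simp add: nn_integral_0_iff_AE)
    thus ?thesis by simp
  next
    case 2
    hence "AE x in M. f x * g x = 0" by (auto simp: b_def Lp_enorm_eq_0_iff)
    hence "(\<integral>\<^sup>+ x. f x * g x \<partial>M) = 0" by (simp add: nn_integral_0_iff_AE)
    thus ?thesis by simp
  next
    case 3
    thus ?thesis unfolding a_def[symmetric] b_def[symmetric]
      by (auto simp: ennreal_mult_top ennreal_top_mult)
  next
    case 4
    define F G where "F = (\<lambda>x. inverse a * f x)" and "G = (\<lambda>x. inverse b * g x)"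
    have [measurable]: "F \<in> borel_measurable M" "G \<in> borel_measurable M"
      by (simp_all add: F_def G_def)
    have inv: "a * inverse a = 1" "b * inverse b = 1"
      using 4 by (simp_all add: ennreal_inverse_mult less_top mult.commute divide_ennreal_def[symmetric])
    have "Lp_enorm M p F = 1" "Lp_enorm M q G = 1"
      using pq inv by (simp_all add: F_def G_def Lp_enorm_cmult mult.commute flip: a_def b_def)
    hence one: "(\<integral>\<^sup>+ x. F x epowr p \<partial>M) = 1" "(\<integral>\<^sup>+ x. G x epowr q \<partial>M) = 1"
      using pq Lp_enorm_epowr[of p M F] Lp_enorm_epowr[of q M G]
      by (simp_all add: epowr_def)
    have "(\<integral>\<^sup>+ x. F x * G x \<partial>M)
        \<le> (\<integral>\<^sup>+ x. ennreal (1 / p) * F x epowr p + ennreal (1 / q) * G x epowr q \<partial>M)"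
      by (intro nn_integral_mono Young_ennreal pq)
    also have "\<dots> = ennreal (1 / p) + ennreal (1 / q)"
      by (simp add: nn_integral_add nn_integral_cmult one)
    also have "\<dots> = 1" using pq by (simp flip: ennreal_plus)
    finally have FG: "(\<integral>\<^sup>+ x. F x * G x \<partial>M) \<le> 1" .
    have "f x * g x = a * b * (F x * G x)" for x
    proof -
      have "a * b * (F x * G x) = (a * inverse a) * (b * inverse b) * (f x * g x)"
        by (simp add: F_def G_def ac_simps)
      thus ?thesis by (simp add: inv)
    qed
    hence "(\<integral>\<^sup>+ x. f x * g x \<partial>M) = a * b * (\<integral>\<^sup>+ x. F x * G x \<partial>M)"
      by (simp add: nn_integral_cmult)
    also have "\<dots> \<le> a * b" using mult_left_mono[OF FG, of "a * b"] by simp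
    finally show ?thesis by (simp add: a_def b_def)
  qed
qed

text \<open>Hoelder's inequality for \<open>f\<^sup>u\<close> against the constant 1, which has norm 1 in every exponent on a
  probability space.\<close>

lemma (in prob_space) Lp_enorm_mono_exponent:
  assumes [measurable]: "f \<in> borel_measurable M" and "0 < u" "u \<le> v"
  shows "Lp_enorm M u f \<le> Lp_enorm M v f"
proof (cases "u = v")
  case False
  define r where "r = v / u"
  have r: "1 < r" "1 < r / (r - 1)" "1 / r + 1 / (r / (r - 1)) = 1"
    using assms False by (simp_all add: r_def field_simps)
  have "(\<integral>\<^sup>+ x. f x epowr u * 1 \<partial>M) \<le> Lp_enorm M r (\<lambda>x. f x epowr u) * Lp_enorm M (r / (r - 1)) (\<lambda>_. 1)"
    using r by (intro Hoelder) auto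
  also have "Lp_enorm M (r / (r - 1)) (\<lambda>_. 1) = 1"
    by (simp add: Lp_enorm_def epowr_def emeasure_space_1)
  finally have "(\<integral>\<^sup>+ x. f x epowr u \<partial>M) \<le> Lp_enorm M r (\<lambda>x. f x epowr u)" by simp
  hence "(\<integral>\<^sup>+ x. f x epowr u \<partial>M) epowr (1 / u) \<le> Lp_enorm M r (\<lambda>x. f x epowr u) epowr (1 / u)"
    using assms by (intro epowr_mono) auto
  thus ?thesis using assms by (simp add: Lp_enorm_def epowr_epowr r_def)
qed simp

lemma SUP_min_of_nat: "(SUP k::nat. min x (of_nat k)) = (x::ennreal)"
proof (rule antisym)
  show "x \<le> (SUP k::nat. min x (of_nat k))"
  proof (cases "x = \<infinity>")
    case True
    thus ?thesis by (simp add: ennreal_SUP_of_nat_eq_top)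
  next
    case False
    then obtain k where "x \<le> of_nat k" by (metis ennreal_Ex_less_of_nat infinity_ennreal_def less_imp_le less_top)
    thus ?thesis by (intro SUP_upper2[of k]) auto
  qed
qed (auto intro!: SUP_least)

text \<open>
  For \<open>r = 1\<close> this is Fubini's theorem. For \<open>r > 1\<close> let \<open>G\<close> be the inner integral. Fubini's theorem and Hoelder's inequality give
  \<open>\<integral>G\<^sup>r = \<integral>\<integral>g G\<^bsup>r - 1\<^esup> \<le> S (\<integral>G\<^sup>r)\<^bsup>1 - 1/r\<^esup>\<close> with \<open>S\<close> the right-hand side, and
  the last factor has to be cancelled. Since \<open>\<integral>G\<^sup>r\<close> may be infinite, the argument is run for
  the truncations \<open>H k = min G k\<close>, which have a finite \<open>r\<close>-th moment because the measure is finite,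
  and \<open>k\<close> then tends to infinity.
\<close>

lemma Minkowski_integral:
  fixes g :: "'a \<Rightarrow> 'b \<Rightarrow> ennreal"
  assumes "finite_measure M" "sigma_finite_measure N"
    and g [measurable]: "case_prod g \<in> borel_measurable (M \<Otimes>\<^sub>M N)" and r: "1 \<le> r"
  shows "Lp_enorm M r (\<lambda>x. \<integral>\<^sup>+ t. g x t \<partial>N) \<le> (\<integral>\<^sup>+ t. Lp_enorm M r (\<lambda>x. g x t) \<partial>N)"
proof -
  interpret M: finite_measure M by fact
  interpret N: sigma_finite_measure N by fact
  interpret pair_sigma_finite M N ..
  have [measurable]: "(\<lambda>x. g x t) \<in> borel_measurable M" if "t \<in> space N" for t
    using that by measurable
  show ?thesis
  proof (cases "r = 1")
    case True
    thus ?thesis by (simp add: Lp_enorm_def Fubini'[OF g])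
  next
    case False
    define q where "q = r / (r - 1)"
    have q: "1 < q" "1 / r + 1 / q = 1" "(r - 1) * q = r" and r1: "1 < r"
      using r False by (simp_all add: q_def field_simps)
    define S where "S = (\<integral>\<^sup>+ t. Lp_enorm M r (\<lambda>x. g x t) \<partial>N)"
    define G where "G = (\<lambda>x. \<integral>\<^sup>+ t. g x t \<partial>N)"
    define H where "H = (\<lambda>k x. min (G x) (of_nat k))"
    have [measurable]: "G \<in> borel_measurable M" "H k \<in> borel_measurable M" for k
      by (simp_all add: G_def H_def)
    have Lp_meas [measurable]: "(\<lambda>t. Lp_enorm M r (\<lambda>x. g x t)) \<in> borel_measurable N"
      unfolding Lp_enorm_def by measurable
    have "Lp_enorm M r (H k) \<le> S" for k
    proof -
      define A where "A = (\<integral>\<^sup>+ x. H k x epowr r \<partial>M)"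
      have "A \<le> (\<integral>\<^sup>+ x. of_nat k epowr r \<partial>M)"
        unfolding A_def H_def using r by (intro nn_integral_mono epowr_mono) auto
      also have "\<dots> < \<infinity>"
        using M.emeasure_finite[of "space M"]
        by (simp add: epowr_def ennreal_mult_eq_top_iff less_top[symmetric])
      finally have A: "A < \<infinity>" .
      \<comment> \<open>Only the first power of \<open>H k\<close> is enlarged to the integral \<open>G\<close>; the remaining power
        \<open>r - 1\<close> lets the right-hand side be expressed through \<open>A\<close>.\<close>
      have "A = (\<integral>\<^sup>+ x. H k x * H k x epowr (r - 1) \<partial>M)"
        unfolding A_def using epowr_add[of _ 1 "r - 1"] by simp
      also have "\<dots> \<le> (\<integral>\<^sup>+ x. G x * H k x epowr (r - 1) \<partial>M)"
        by (intro nn_integral_mono mult_right_mono) (auto simp: H_def)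
      also have "\<dots> = (\<integral>\<^sup>+ x. \<integral>\<^sup>+ t. g x t * H k x epowr (r - 1) \<partial>N \<partial>M)"
        unfolding G_def by (intro nn_integral_cong) (simp add: nn_integral_multc)
      also have "\<dots> = (\<integral>\<^sup>+ t. \<integral>\<^sup>+ x. g x t * H k x epowr (r - 1) \<partial>M \<partial>N)"
        by (intro Fubini'[symmetric]) measurable
      also have "\<dots> \<le> (\<integral>\<^sup>+ t. Lp_enorm M r (\<lambda>x. g x t) * Lp_enorm M q (\<lambda>x. H k x epowr (r - 1)) \<partial>N)"
        using q r1 by (intro nn_integral_mono Hoelder) auto
      also have "Lp_enorm M q (\<lambda>x. H k x epowr (r - 1)) = A epowr (1 / q)"
        using q by (simp add: Lp_enorm_def A_def epowr_epowr)
      finally have le: "A \<le> S * A epowr (1 / q)"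
        unfolding S_def by (simp add: nn_integral_multc)
      show ?thesis
      proof (cases "A = 0")
        case True
        thus ?thesis by (simp add: Lp_enorm_def A_def epowr_def)
      next
        case False
        have "A = A epowr (1 / r) * A epowr (1 / q)" by (simp add: q(2) flip: epowr_add)
        with le have "A epowr (1 / r) * A epowr (1 / q) \<le> S * A epowr (1 / q)" by simp
        moreover have "A epowr (1 / q) \<noteq> 0" "A epowr (1 / q) \<noteq> \<infinity>" using False A by auto
        ultimately have "A epowr (1 / r) \<le> S"
          by (metis ennreal_mult_le_mult_iff infinity_ennreal_def mult.commute)
        thus ?thesis by (simp add: Lp_enorm_def A_def)
      qed
    qed
    hence le: "(\<integral>\<^sup>+ x. H k x epowr r \<partial>M) \<le> S epowr r" for k
      using epowr_mono[of "Lp_enorm M r (H k)" S r] r by (simp add: Lp_enorm_epowr)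
    have "(\<integral>\<^sup>+ x. G x epowr r \<partial>M) = (\<integral>\<^sup>+ x. (SUP k. H k x epowr r) \<partial>M)"
      using r by (simp add: H_def SUP_min_of_nat flip: SUP_epowr)
    also have "\<dots> = (SUP k. \<integral>\<^sup>+ x. H k x epowr r \<partial>M)"
      using r by (intro nn_integral_monotone_convergence_SUP)
        (auto simp: incseq_def le_fun_def H_def min_le_iff_disj intro!: epowr_mono min.mono)
    also have "\<dots> \<le> S epowr r" by (intro SUP_least le)
    finally have "(\<integral>\<^sup>+ x. G x epowr r \<partial>M) epowr (1 / r) \<le> (S epowr r) epowr (1 / r)"
      using r by (intro epowr_mono) auto
    thus ?thesis using r by (simp add: epowr_epowr Lp_enorm_def S_def G_def)
  qed
qed

text \<open>Interchanging the order of two norms increases the result when the larger exponent moves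
  inside: this is Minkowski's inequality for \<open>g\<^sup>p\<close> and the exponent \<open>v / p \<ge> 1\<close>.\<close>

lemma Lp_enorm_swap:
  fixes g :: "'a \<Rightarrow> 'b \<Rightarrow> ennreal"
  assumes "finite_measure M" "sigma_finite_measure N"
    and g [measurable]: "case_prod g \<in> borel_measurable (M \<Otimes>\<^sub>M N)" and pv: "0 < p" "p \<le> v"
  shows "Lp_enorm M v (\<lambda>x. Lp_enorm N p (g x)) \<le> Lp_enorm N p (\<lambda>t. Lp_enorm M v (\<lambda>x. g x t))"
proof -
  have "Lp_enorm M (v / p) (\<lambda>x. \<integral>\<^sup>+ t. g x t epowr p \<partial>N) epowr (1 / p)
      \<le> (\<integral>\<^sup>+ t. Lp_enorm M (v / p) (\<lambda>x. g x t epowr p) \<partial>N) epowr (1 / p)"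
    using assms(1,2) pv by (intro epowr_mono Minkowski_integral) auto
  thus ?thesis using pv by (simp add: Lp_enorm_def epowr_epowr)
qed

text \<open>A sum of two functions is an integral over a two-point space.\<close>

lemma Lp_enorm_triangle:
  assumes "finite_measure M" and [measurable]: "f \<in> borel_measurable M" "g \<in> borel_measurable M"
    and "1 \<le> r"
  shows "Lp_enorm M r (\<lambda>x. f x + g x) \<le> Lp_enorm M r f + Lp_enorm M r g"
proof -
  have "Lp_enorm M r (\<lambda>x. \<integral>\<^sup>+ b. (if b then f x else g x) \<partial>count_space UNIV)
      \<le> (\<integral>\<^sup>+ b. Lp_enorm M r (\<lambda>x. if b then f x else g x) \<partial>count_space UNIV)"
    using assms by (intro Minkowski_integral sigma_finite_measure_count_space_finite) auto
  thus ?thesis by (simp add: nn_integral_count_space_finite UNIV_bool add.commute)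
qed

text \<open>
  The majorant \<open>g\<close> is an arbitrary function, so its integral is a lower integral. The constant is
  therefore moved to the measurable side: \<open>f / c \<le> g\<close> can be integrated by monotonicity alone. The
  lemma serves for the majorant \<open>t \<mapsto> \<parallel>\<xi>(t)\<parallel>\<^sub>\<psi>\<close>, a supremum over uncountably many exponents.
\<close>

lemma Lp_enorm_le_cmult:
  assumes [measurable]: "f \<in> borel_measurable M" and "0 < p" "0 \<le> c"
    and le: "\<And>x. x \<in> space M \<Longrightarrow> f x \<le> ennreal c * g x"
  shows "Lp_enorm M p f \<le> ennreal c * Lp_enorm M p g"
proof (cases "c = 0")
  case True
  hence "Lp_enorm M p f = 0" using le by (subst Lp_enorm_eq_0_iff) auto
  thus ?thesis by simp
next
  case False
  have one: "ennreal c * ennreal (1 / c) = 1" "ennreal (1 / c) * ennreal c = 1"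
    using False assms(3) by (simp_all flip: ennreal_mult)
  have "Lp_enorm M p f = ennreal c * (ennreal (1 / c) * Lp_enorm M p f)"
    by (simp add: one flip: mult.assoc)
  also have "ennreal (1 / c) * Lp_enorm M p f = Lp_enorm M p (\<lambda>x. ennreal (1 / c) * f x)"
    using assms(2) by (simp add: Lp_enorm_cmult)
  also have "\<dots> \<le> Lp_enorm M p g"
  proof (rule Lp_enorm_mono)
    fix x assume "x \<in> space M"
    hence "ennreal (1 / c) * f x \<le> ennreal (1 / c) * (ennreal c * g x)"
      by (intro mult_left_mono le) auto
    thus "ennreal (1 / c) * f x \<le> g x" by (simp add: one flip: mult.assoc)
  qed (use assms in simp)
  finally show ?thesis by (simp add: mult_left_mono)
qed

section \<open>The norm of the space of random variables\<close>

lemma psi_enorm_eq: "psi_enorm M \<psi> X = (SUP u\<in>{1..}. Lp_enorm M u X / ennreal (\<psi> u))"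
  by (simp add: psi_enorm_def Lp_enorm_def)

lemma psi_functionD:
  assumes "psi_function \<psi>"
  shows "1 \<le> u \<Longrightarrow> 0 < \<psi> u" "1 \<le> u \<Longrightarrow> u \<le> v \<Longrightarrow> \<psi> u \<le> \<psi> v"
  using assms by (auto simp: psi_function_def mono_on_def)

lemma psi_enorm_le_iff:
  assumes "psi_function \<psi>"
  shows "psi_enorm M \<psi> X \<le> B \<longleftrightarrow> (\<forall>u\<ge>1. Lp_enorm M u X \<le> B * ennreal (\<psi> u))"
proof -
  have "a / ennreal (\<psi> u) \<le> B \<longleftrightarrow> a \<le> B * ennreal (\<psi> u)" if "1 \<le> u" for a u
  proof
    have pos: "ennreal (\<psi> u) \<noteq> 0" "ennreal (\<psi> u) < \<infinity>"
      using psi_functionD(1)[OF assms that] by auto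
    show "a \<le> B * ennreal (\<psi> u)" if "a / ennreal (\<psi> u) \<le> B"
      using mult_right_mono[OF that, of "ennreal (\<psi> u)"] pos by (simp add: ennreal_divide_times ennreal_mult_divide_eq)
    show "a / ennreal (\<psi> u) \<le> B" if "a \<le> B * ennreal (\<psi> u)"
      using divide_right_mono_ennreal[OF that, of "ennreal (\<psi> u)"] pos by (simp add: ennreal_mult_divide_eq)
  qed
  thus ?thesis unfolding psi_enorm_eq SUP_le_iff by auto
qed

lemma Lp_enorm_le_psi_enorm:
  assumes "psi_function \<psi>" "1 \<le> u"
  shows "Lp_enorm M u X \<le> psi_enorm M \<psi> X * ennreal (\<psi> u)"
  using psi_enorm_le_iff[OF assms(1), of M X "psi_enorm M \<psi> X"] assms(2) by simp

lemma psi_norm_cmult_le: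
  assumes "psi_function \<psi>" and [measurable]: "X \<in> borel_measurable M"
  shows "psi_norm M \<psi> (\<lambda>\<omega>. c * X \<omega>) \<le> ennreal \<bar>c\<bar> * psi_norm M \<psi> X"
  unfolding psi_norm_def psi_enorm_le_iff[OF assms(1)]
proof (intro allI impI)
  fix u :: real assume u: "1 \<le> u"
  have "Lp_enorm M u (\<lambda>\<omega>. ennreal \<bar>c * X \<omega>\<bar>) = ennreal \<bar>c\<bar> * Lp_enorm M u (\<lambda>\<omega>. ennreal \<bar>X \<omega>\<bar>)"
    using u by (subst Lp_enorm_cmult[symmetric]) (auto simp: abs_mult ennreal_mult)
  also have "\<dots> \<le> ennreal \<bar>c\<bar> * (psi_enorm M \<psi> (\<lambda>\<omega>. ennreal \<bar>X \<omega>\<bar>) * ennreal (\<psi> u))"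
    using assms u by (intro mult_left_mono Lp_enorm_le_psi_enorm) auto
  finally show "Lp_enorm M u (\<lambda>\<omega>. ennreal \<bar>c * X \<omega>\<bar>)
      \<le> ennreal \<bar>c\<bar> * psi_enorm M \<psi> (\<lambda>\<omega>. ennreal \<bar>X \<omega>\<bar>) * ennreal (\<psi> u)"
    by (simp add: mult.assoc)
qed

lemma integrable_psi_space:
  assumes "psi_function \<psi>" "X \<in> psi_space M \<psi>"
  shows "integrable M X"
proof -
  have "Lp_enorm M 1 (\<lambda>\<omega>. ennreal \<bar>X \<omega>\<bar>) \<le> psi_norm M \<psi> X * ennreal (\<psi> 1)"
    unfolding psi_norm_def using assms by (intro Lp_enorm_le_psi_enorm) auto
  also have "\<dots> < \<infinity>" using assms by (simp add: psi_space_def ennreal_mult_less_top)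
  finally show ?thesis using assms
    by (simp add: Lp_enorm_def integrable_iff_bounded psi_space_def)
qed

text \<open>The constant \<open>E X\<close> has norm \<open>\<bar>E X\<bar> \<le> E \<bar>X\<bar>\<close> in every \<open>L\<^sub>u\<close>, and this is at most the
  \<open>L\<^sub>u\<close> norm of \<open>X\<close>; hence the factor 2 by the triangle inequality.\<close>

lemma (in prob_space) psi_norm_centered:
  assumes psi: "psi_function \<psi>" and X: "X \<in> psi_space M \<psi>"
  shows "psi_norm M \<psi> (\<lambda>\<omega>. X \<omega> - expectation X) \<le> 2 * psi_norm M \<psi> X"
  unfolding psi_norm_def psi_enorm_le_iff[OF psi]
proof (intro allI impI)
  fix u :: real assume u: "1 \<le> u"
  have [measurable]: "X \<in> borel_measurable M" using X by (simp add: psi_space_def)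
  let ?L = "Lp_enorm M u (\<lambda>\<omega>. ennreal \<bar>X \<omega>\<bar>)"
  have "ennreal \<bar>expectation X\<bar> \<le> (\<integral>\<^sup>+ \<omega>. ennreal \<bar>X \<omega>\<bar> \<partial>M)"
    using integral_norm_bound_ennreal[OF integrable_psi_space[OF assms]] by simp
  also have "\<dots> = Lp_enorm M 1 (\<lambda>\<omega>. ennreal \<bar>X \<omega>\<bar>)" by (simp add: Lp_enorm_def)
  also have "\<dots> \<le> ?L" using u by (intro Lp_enorm_mono_exponent) auto
  finally have E: "ennreal \<bar>expectation X\<bar> \<le> ?L" .
  have "Lp_enorm M u (\<lambda>\<omega>. ennreal \<bar>X \<omega> - expectation X\<bar>)
      \<le> Lp_enorm M u (\<lambda>\<omega>. ennreal \<bar>X \<omega>\<bar> + ennreal \<bar>expectation X\<bar>)"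
    using u by (intro Lp_enorm_mono) (auto simp flip: ennreal_plus intro!: ennreal_leI)
  also have "\<dots> \<le> ?L + Lp_enorm M u (\<lambda>\<omega>. ennreal \<bar>expectation X\<bar>)"
    using u by (intro Lp_enorm_triangle finite_measure_axioms) auto
  also have "Lp_enorm M u (\<lambda>\<omega>. ennreal \<bar>expectation X\<bar>) = ennreal \<bar>expectation X\<bar>"
    using u by (simp add: Lp_enorm_def emeasure_space_1 epowr_epowr)
  also have "?L + ennreal \<bar>expectation X\<bar> \<le> 2 * ?L"
    using E by (simp add: mult_2 add_left_mono)
  also have "\<dots> \<le> 2 * (psi_enorm M \<psi> (\<lambda>\<omega>. ennreal \<bar>X \<omega>\<bar>) * ennreal (\<psi> u))"
    using psi u by (intro mult_left_mono Lp_enorm_le_psi_enorm) auto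
  finally show "Lp_enorm M u (\<lambda>\<omega>. ennreal \<bar>X \<omega> - expectation X\<bar>)
      \<le> 2 * psi_enorm M \<psi> (\<lambda>\<omega>. ennreal \<bar>X \<omega>\<bar>) * ennreal (\<psi> u)"
    by (simp add: mult.assoc)
qed

text \<open>The only place where independence and condition \<open>H\<close> enter. The summands
  \<open>(X\<^sub>i - E X\<^sub>i) / n\<close> have norm at most \<open>2 K / n\<close>, so the square of the norm of their sum is at
  most \<open>C \<cdot> n \<cdot> (2 K / n)\<^sup>2 = 4 C K\<^sup>2 / n\<close>.\<close>

lemma (in prob_space) psi_norm_centered_mean:
  fixes X :: "nat \<Rightarrow> 'a \<Rightarrow> real"
  assumes psi: "psi_function \<psi>" and H: "condition_H M \<psi> C" "0 \<le> C" and n: "1 \<le> n"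
    and indep: "indep_vars (\<lambda>_. borel) X {1..n}"
    and X: "\<And>i. i \<in> {1..n} \<Longrightarrow> X i \<in> psi_space M \<psi>"
    and K: "\<And>i. i \<in> {1..n} \<Longrightarrow> psi_norm M \<psi> (X i) \<le> K"
  shows "psi_norm M \<psi> (\<lambda>\<omega>. 1 / real n * (\<Sum>i=1..n. X i \<omega> - expectation (X i)))
           \<le> ennreal (2 * sqrt C / sqrt (real n)) * K"
proof -
  define Y where "Y = (\<lambda>i \<omega>. 1 / real n * (X i \<omega> - expectation (X i)))"
  have X_meas [measurable]: "X i \<in> borel_measurable M" if "i \<in> {1..n}" for i
    using X[OF that] by (simp add: psi_space_def)
  have Y_le: "psi_norm M \<psi> (Y i) \<le> ennreal (2 / real n) * psi_norm M \<psi> (X i)" if i: "i \<in> {1..n}" for i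
  proof -
    have "psi_norm M \<psi> (Y i) \<le> ennreal \<bar>1 / real n\<bar> * psi_norm M \<psi> (\<lambda>\<omega>. X i \<omega> - expectation (X i))"
      unfolding Y_def using i by (intro psi_norm_cmult_le psi) auto
    also have "\<dots> \<le> ennreal \<bar>1 / real n\<bar> * (2 * psi_norm M \<psi> (X i))"
      using i by (intro mult_left_mono psi_norm_centered psi X) auto
    also have "\<dots> = ennreal (1 / real n) * ennreal 2 * psi_norm M \<psi> (X i)"
      by (simp add: mult.assoc)
    also have "ennreal (1 / real n) * ennreal 2 = ennreal (2 / real n)"
      by (subst ennreal_mult[symmetric]) auto
    finally show ?thesis .
  qed
  have Y: "Y i \<in> psi_space M \<psi>" "expectation (Y i) = 0" if i: "i \<in> {1..n}" for i
  proof -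
    have "ennreal (2 / real n) * psi_norm M \<psi> (X i) < \<infinity>"
      using X[OF i] by (simp add: psi_space_def ennreal_mult_less_top)
    with Y_le[OF i] have "psi_norm M \<psi> (Y i) < \<infinity>" by (rule le_less_trans)
    moreover have "Y i \<in> borel_measurable M" unfolding Y_def using i by measurable
    ultimately show "Y i \<in> psi_space M \<psi>" by (simp add: psi_space_def)
    show "expectation (Y i) = 0"
      using integrable_psi_space[OF psi X[OF i]] by (simp add: Y_def prob_space)
  qed
  have "indep_vars (\<lambda>_. borel) Y {1..n}"
    unfolding Y_def by (rule indep_vars_compose2[OF indep]) measurable
  with H(1) Y have "(psi_norm M \<psi> (\<lambda>\<omega>. \<Sum>i=1..n. Y i \<omega>))\<^sup>2
      \<le> ennreal C * (\<Sum>i=1..n. (psi_norm M \<psi> (Y i))\<^sup>2)"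
    unfolding condition_H_def by blast
  also have "\<dots> \<le> ennreal C * (\<Sum>i=1..n. (ennreal (2 / real n) * K)\<^sup>2)"
    by (intro mult_left_mono sum_mono power_mono_ennreal order_trans[OF Y_le] K) auto
  also have "\<dots> = ennreal C * (ennreal (real n) * ennreal ((2 / real n)\<^sup>2)) * K\<^sup>2"
    by (simp add: power_mult_distrib ennreal_power ennreal_of_nat_eq_real_of_nat mult.assoc)
  also have "ennreal C * (ennreal (real n) * ennreal ((2 / real n)\<^sup>2))
      = ennreal ((2 * sqrt C / sqrt (real n))\<^sup>2)"
    using H(2) n by (simp add: power2_eq_square field_simps flip: ennreal_mult)
  also have "\<dots> * K\<^sup>2 = (ennreal (2 * sqrt C / sqrt (real n)) * K)\<^sup>2"
    using H(2) by (simp add: power_mult_distrib ennreal_power)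
  finally have "(psi_norm M \<psi> (\<lambda>\<omega>. \<Sum>i=1..n. Y i \<omega>) epowr 2) epowr (1/2)
      \<le> ((ennreal (2 * sqrt C / sqrt (real n)) * K) epowr 2) epowr (1/2)"
    unfolding epowr_two by (rule epowr_mono) simp
  thus ?thesis by (simp add: epowr_epowr Y_def sum_distrib_left)
qed

text \<open>
  To exchange the \<open>L\<^sub>u\<close> norm over \<open>\<omega>\<close> with the \<open>L\<^sub>p\<close> norm over \<open>t\<close> the exponent \<open>u\<close> has to be
  raised to \<open>v = max u p\<close>. The pointwise bound then brings the factor \<open>\<psi> v\<close>, and
  \<open>\<psi> v \<le> (\<psi> p / \<psi> 1) \<psi> u\<close> by monotonicity, using \<open>\<psi> 1 \<le> \<psi> p\<close> if \<open>v = u\<close> and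
  \<open>\<psi> 1 \<le> \<psi> u\<close> if \<open>v = p\<close>.
\<close>

lemma (in prob_space) psi_enorm_Lp_enorm_le:
  fixes g :: "'a \<Rightarrow> 'b \<Rightarrow> ennreal"
  assumes psi: "psi_function \<psi>" and N: "sigma_finite_measure N"
    and g [measurable]: "case_prod g \<in> borel_measurable (M \<Otimes>\<^sub>M N)"
    and p: "1 \<le> p" and c: "0 \<le> c"
    and le: "\<And>t. t \<in> space N \<Longrightarrow> psi_enorm M \<psi> (\<lambda>\<omega>. g \<omega> t) \<le> ennreal c * K t"
  shows "psi_enorm M \<psi> (\<lambda>\<omega>. Lp_enorm N p (g \<omega>)) \<le> ennreal (c * (\<psi> p / \<psi> 1)) * Lp_enorm N p K"
  unfolding psi_enorm_le_iff[OF psi]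
proof (intro allI impI)
  fix u :: real assume u: "1 \<le> u"
  interpret N: sigma_finite_measure N by fact
  define v where "v = max u p"
  note pos = psi_functionD(1)[OF psi]
  have v: "1 \<le> v" "u \<le> v" "p \<le> v" using u by (auto simp: v_def)
  have [measurable]: "(\<lambda>\<omega>. Lp_enorm N p (g \<omega>)) \<in> borel_measurable M"
    "(\<lambda>t. Lp_enorm M v (\<lambda>\<omega>. g \<omega> t)) \<in> borel_measurable N"
    unfolding Lp_enorm_def by measurable
  have psi_v: "\<psi> v \<le> \<psi> p / \<psi> 1 * \<psi> u"
  proof (cases "p \<le> u")
    case True
    have "\<psi> 1 * \<psi> u \<le> \<psi> p * \<psi> u"
      using psi_functionD[OF psi] p u by (intro mult_right_mono) (auto simp: less_imp_le)
    thus ?thesis using True pos[of 1] by (simp add: v_def field_simps)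
  next
    case False
    have "\<psi> p * \<psi> 1 \<le> \<psi> p * \<psi> u"
      using psi_functionD[OF psi] p u by (intro mult_left_mono) (auto simp: less_imp_le)
    thus ?thesis using False pos[of 1] by (simp add: v_def field_simps)
  qed
  have "Lp_enorm M u (\<lambda>\<omega>. Lp_enorm N p (g \<omega>)) \<le> Lp_enorm M v (\<lambda>\<omega>. Lp_enorm N p (g \<omega>))"
    using u v by (intro Lp_enorm_mono_exponent) auto
  also have "\<dots> \<le> Lp_enorm N p (\<lambda>t. Lp_enorm M v (\<lambda>\<omega>. g \<omega> t))"
    using p v N by (intro Lp_enorm_swap g finite_measure_axioms) auto
  also have "\<dots> \<le> ennreal (c * \<psi> v) * Lp_enorm N p K"
  proof (rule Lp_enorm_le_cmult)
    fix t assume t: "t \<in> space N"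
    have "Lp_enorm M v (\<lambda>\<omega>. g \<omega> t) \<le> psi_enorm M \<psi> (\<lambda>\<omega>. g \<omega> t) * ennreal (\<psi> v)"
      using psi v by (intro Lp_enorm_le_psi_enorm)
    also have "\<dots> \<le> ennreal c * K t * ennreal (\<psi> v)" by (intro mult_right_mono le t) auto
    also have "\<dots> = ennreal (c * \<psi> v) * K t"
      using c pos[OF v(1)] by (simp add: ennreal_mult ac_simps)
    finally show "Lp_enorm M v (\<lambda>\<omega>. g \<omega> t) \<le> ennreal (c * \<psi> v) * K t" .
  qed (use p c pos[OF v(1)] in auto)
  also have "\<dots> \<le> ennreal (c * (\<psi> p / \<psi> 1) * \<psi> u) * Lp_enorm N p K"
    using mult_left_mono[OF psi_v c] by (intro mult_right_mono ennreal_leI) (auto simp: mult.assoc)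
  also have "\<dots> = ennreal (c * (\<psi> p / \<psi> 1)) * Lp_enorm N p K * ennreal (\<psi> u)"
    using c pos[OF p] pos[OF u] pos[of 1]
    by (subst ennreal_mult) (auto simp: ac_simps intro!: mult_nonneg_nonneg)
  finally show "Lp_enorm M u (\<lambda>\<omega>. Lp_enorm N p (g \<omega>)) \<le> \<dots>" .
qed

text \<open>Markov's inequality for the \<open>u\<close>-th moment, which is at most \<open>(B \<psi>(u))\<^sup>u\<close>.\<close>

lemma psi_enorm_tail_bound:
  assumes psi: "psi_function \<psi>" and [measurable]: "Y \<in> borel_measurable M"
    and B: "psi_enorm M \<psi> Y \<le> B" and "0 < \<epsilon>" "1 \<le> u"
  shows "emeasure M {\<omega> \<in> space M. Y \<omega> > ennreal \<epsilon>}
           \<le> (B epowr u * ennreal (\<psi> u powr u)) / ennreal (\<epsilon> powr u)"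
proof -
  let ?c = "inverse (ennreal (\<epsilon> powr u))"
  have "emeasure M {\<omega> \<in> space M. Y \<omega> > ennreal \<epsilon>}
      \<le> emeasure M {\<omega> \<in> space M. 1 \<le> ?c * Y \<omega> epowr u}"
  proof (rule emeasure_mono)
    show "{\<omega> \<in> space M. Y \<omega> > ennreal \<epsilon>} \<subseteq> {\<omega> \<in> space M. 1 \<le> ?c * Y \<omega> epowr u}"
    proof clarsimp
      fix \<omega> assume "ennreal \<epsilon> < Y \<omega>"
      hence "ennreal (\<epsilon> powr u) \<le> Y \<omega> epowr u"
        using assms epowr_mono[of "ennreal \<epsilon>" "Y \<omega>" u] by (simp add: epowr_ennreal)
      hence "?c * ennreal (\<epsilon> powr u) \<le> ?c * Y \<omega> epowr u" by (rule mult_left_mono) simp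
      thus "1 \<le> ?c * Y \<omega> epowr u"
        using \<open>0 < \<epsilon>\<close> by (simp add: inverse_ennreal flip: ennreal_mult)
    qed
  qed simp
  also have "\<dots> \<le> ?c * (\<integral>\<^sup>+ \<omega>. Y \<omega> epowr u * indicator (space M) \<omega> \<partial>M)"
    by (rule nn_integral_Markov_inequality) auto
  also have "\<dots> = Lp_enorm M u Y epowr u * ?c"
    using assms by (simp add: Lp_enorm_epowr mult.commute flip: nn_integral_indicator cong: nn_integral_cong)
  also have "\<dots> \<le> (B * ennreal (\<psi> u)) epowr u * ?c"
    using assms psi_enorm_le_iff[OF psi, of M Y B] by (intro mult_right_mono epowr_mono) auto
  finally show ?thesis
    using psi_functionD(1)[OF psi \<open>1 \<le> u\<close>] by (simp add: divide_ennreal_def epowr_mult epowr_ennreal)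
qed

section \<open>Monte Carlo approximation in \<open>L\<^sub>p\<close>\<close>

theorem theorem9p8:
  fixes \<mu> P :: "'s measure" and dens :: "'s \<Rightarrow> real"
    and T :: "'t::metric_space set" and \<nu> :: "'t measure"
    and f :: "'s \<Rightarrow> 't \<Rightarrow> real" and I :: "'t \<Rightarrow> real"
    and \<psi> :: "real \<Rightarrow> real" and C :: real
    and M :: "'w measure" and s :: "nat \<Rightarrow> 'w \<Rightarrow> 's" and n :: nat
    and Z Zc :: "'w \<Rightarrow> 't \<Rightarrow> real" and p :: real
  assumes mu: "sigma_finite_measure \<mu>"
    and dens: "dens \<in> borel_measurable \<mu>" "\<And>x. x \<in> space \<mu> \<Longrightarrow> 0 \<le> dens x"
      "(\<integral>x. dens x \<partial>\<mu>) = 1"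
    and P: "P = density \<mu> (\<lambda>x. ennreal (dens x))"
    and T: "compact T"
    and nu: "sigma_finite_measure \<nu>" "space \<nu> = T" "sets (restrict_space borel T) \<subseteq> sets \<nu>"
    and f_meas: "(\<lambda>(x, t). f x t) \<in> borel_measurable (\<mu> \<Otimes>\<^sub>M \<nu>)"
    and f_cont: "\<And>x. x \<in> space \<mu> \<Longrightarrow> continuous_on T (f x)"
    and I_exists: "\<And>t. t \<in> T \<Longrightarrow> integrable \<mu> (\<lambda>x. f x t * dens x)"
    and I: "\<And>t. t \<in> T \<Longrightarrow> I t = (\<integral>x. f x t * dens x \<partial>\<mu>)"
    and psi: "psi_function \<psi>"
    and xi_in_space: "\<And>t. t \<in> T \<Longrightarrow> (\<lambda>x. f x t) \<in> psi_space P \<psi>"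
    and M: "prob_space M"
    and H: "0 \<le> C" "condition_H M \<psi> C"
    and n: "1 \<le> n"
    and copies: "prob_space.indep_vars M (\<lambda>_. \<mu>) s {1..n}"
      "\<And>i. i \<in> {1..n} \<Longrightarrow> distr M \<mu> (s i) = P"
    and Z: "Z = (\<lambda>\<omega> t. 1 / real n * (\<Sum>i=1..n. f (s i \<omega>) t))"
    and Zc: "Zc = (\<lambda>\<omega> t. 1 / real n * (\<Sum>i=1..n. (f (s i \<omega>) t - I t)))"
    and p: "1 \<le> p"
  shows "psi_enorm M \<psi> (\<lambda>\<omega>. Lp_enorm \<nu> p (\<lambda>t. ennreal \<bar>Zc \<omega> t\<bar>))
           \<le> ennreal (2 * sqrt C / sqrt (real n) * (\<psi> p / \<psi> 1))
              * (\<integral>\<^sup>+ t. psi_norm P \<psi> (\<lambda>x. f x t) epowr p \<partial>\<nu>) epowr (1 / p)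
         \<and> (\<forall>\<epsilon> \<delta>. 0 < \<epsilon> \<and> 0 \<le> \<delta> \<and>
           (INF u\<in>{1..}.
              ennreal ((2 * sqrt C / sqrt (real n) * (\<psi> p / \<psi> 1)) powr u)
              * (\<integral>\<^sup>+ t. psi_norm P \<psi> (\<lambda>x. f x t) epowr p \<partial>\<nu>) epowr (u / p)
              * ennreal (\<psi> u powr u) / ennreal (\<epsilon> powr u)) \<le> ennreal \<delta>
           \<longrightarrow> approximates_in_Lp M \<nu> p Z I \<delta> \<epsilon>)"

proof -
  interpret mu: sigma_finite_measure \<mu> by fact
  interpret M: prob_space M by fact
  define K where "K = (\<lambda>t. psi_norm P \<psi> (\<lambda>x. f x t))"
  define a where "a = 2 * sqrt C / sqrt (real n)"
  define Y where "Y = (\<lambda>\<omega>. Lp_enorm \<nu> p (\<lambda>t. ennreal \<bar>Zc \<omega> t\<bar>))"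
  have a: "0 \<le> a" using H by (simp add: a_def)
  have s_meas [measurable]: "s i \<in> measurable M \<mu>" if "i \<in> {1..n}" for i
    using copies(1) that by (simp add: M.indep_vars_def)
  have sets_P [measurable_cong]: "sets P = sets \<mu>" by (simp add: P)
  have ft_meas [measurable]: "(\<lambda>x. f x t) \<in> borel_measurable \<mu>" if "t \<in> T" for t
    using xi_in_space[OF that] by (simp add: psi_space_def cong: measurable_cong_sets sets_P)
  \<comment> \<open>Each \<open>\<xi>\<^sub>i(t)\<close> has the law of \<open>\<xi>(t)\<close>, hence the same norm and the mean \<open>I(t)\<close>.\<close>
  have Lp_copy: "Lp_enorm M u (\<lambda>\<omega>. ennreal \<bar>f (s i \<omega>) t\<bar>) = Lp_enorm P u (\<lambda>x. ennreal \<bar>f x t\<bar>)"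
    if "i \<in> {1..n}" "t \<in> T" for i t u
    using that unfolding copies(2)[OF that(1), symmetric] by (simp add: Lp_enorm_def nn_integral_distr)
  have psi_copy: "psi_norm M \<psi> (\<lambda>\<omega>. f (s i \<omega>) t) = K t" if "i \<in> {1..n}" "t \<in> T" for i t
    using that by (simp add: K_def psi_norm_def psi_enorm_eq Lp_copy)
  have mean: "M.expectation (\<lambda>\<omega>. f (s i \<omega>) t) = I t" if "i \<in> {1..n}" "t \<in> T" for i t
  proof -
    have "M.expectation (\<lambda>\<omega>. f (s i \<omega>) t) = (\<integral>x. f x t \<partial>P)"
      using that unfolding copies(2)[OF that(1), symmetric] by (simp add: integral_distr)
    also have "\<dots> = (\<integral>x. dens x * f x t \<partial>\<mu>)"
      using that dens unfolding P by (subst integral_real_density) auto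
    finally show ?thesis using I[OF that(2)] by (simp add: mult.commute)
  qed
  have pointwise: "psi_enorm M \<psi> (\<lambda>\<omega>. ennreal \<bar>Zc \<omega> t\<bar>) \<le> ennreal a * K t" if t: "t \<in> space \<nu>" for t
  proof -
    have tT: "t \<in> T" using t nu by simp
    have "psi_norm M \<psi> (\<lambda>\<omega>. 1 / real n * (\<Sum>i=1..n. f (s i \<omega>) t - M.expectation (\<lambda>\<omega>. f (s i \<omega>) t)))
        \<le> ennreal (2 * sqrt C / sqrt (real n)) * K t"
    proof (rule M.psi_norm_centered_mean[OF psi H(2,1) n])
      show "M.indep_vars (\<lambda>_. borel) (\<lambda>i \<omega>. f (s i \<omega>) t) {1..n}"
        using tT by (intro M.indep_vars_compose2[OF copies(1)]) auto
    next
      fix i assume i: "i \<in> {1..n}"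
      show "psi_norm M \<psi> (\<lambda>\<omega>. f (s i \<omega>) t) \<le> K t" using psi_copy[OF i tT] by simp
      have "(\<lambda>\<omega>. f (s i \<omega>) t) \<in> borel_measurable M"
        using i tT by (intro measurable_compose[OF s_meas ft_meas])
      thus "(\<lambda>\<omega>. f (s i \<omega>) t) \<in> psi_space M \<psi>"
        using xi_in_space[OF tT] psi_copy[OF i tT] by (simp add: psi_space_def K_def)
    qed
    thus ?thesis using mean tT by (simp add: psi_norm_def Zc a_def)
  qed
  have f_meas' [measurable]: "(\<lambda>z. f (fst z) (snd z)) \<in> borel_measurable (\<mu> \<Otimes>\<^sub>M \<nu>)"
    using f_meas by (simp add: case_prod_beta')
  have fs_meas [measurable]: "(\<lambda>z. f (s i (fst z)) (snd z)) \<in> borel_measurable (M \<Otimes>\<^sub>M \<nu>)"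
    if [measurable]: "i \<in> {1..n}" for i
  proof -
    have "(\<lambda>z. (s i (fst z), snd z)) \<in> measurable (M \<Otimes>\<^sub>M \<nu>) (\<mu> \<Otimes>\<^sub>M \<nu>)"
      using s_meas[OF that] by measurable
    from measurable_compose[OF this f_meas'] show ?thesis by simp
  qed
  \<comment> \<open>\<open>I\<close> is measurable as a parameter integral; Minkowski's inequality needs the centred process
    to be jointly measurable.\<close>
  have "(\<lambda>z. f (snd z) (fst z) * dens (snd z)) \<in> borel_measurable (\<nu> \<Otimes>\<^sub>M \<mu>)"
    using measurable_compose[OF measurable_pair_swap' f_meas] dens(1)
    by (simp add: case_prod_beta')
  hence "(\<lambda>t. \<integral>x. f x t * dens x \<partial>\<mu>) \<in> borel_measurable \<nu>"
    by (intro mu.borel_measurable_lebesgue_integral) (simp add: case_prod_beta')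
  hence I_meas [measurable]: "I \<in> borel_measurable \<nu>"
    using I nu(2) measurable_cong[of \<nu> I "\<lambda>t. \<integral>x. f x t * dens x \<partial>\<mu>" borel] by simp
  have Zc_meas [measurable]: "(\<lambda>(\<omega>, t). ennreal \<bar>Zc \<omega> t\<bar>) \<in> borel_measurable (M \<Otimes>\<^sub>M \<nu>)"
    unfolding Zc case_prod_beta' by measurable
  interpret nu: sigma_finite_measure \<nu> by fact
  have Y_meas [measurable]: "Y \<in> borel_measurable M"
    unfolding Y_def Lp_enorm_def by measurable
  have norm: "psi_enorm M \<psi> Y \<le> ennreal (a * (\<psi> p / \<psi> 1)) * Lp_enorm \<nu> p K"
    unfolding Y_def by (intro M.psi_enorm_Lp_enorm_le psi nu(1) Zc_meas p a pointwise)
  have "approximates_in_Lp M \<nu> p Z I \<delta> \<epsilon>"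
    if "0 < \<epsilon>" "0 \<le> \<delta>" and inf: "(INF u\<in>{1..}. ennreal ((a * (\<psi> p / \<psi> 1)) powr u)
              * (\<integral>\<^sup>+ t. K t epowr p \<partial>\<nu>) epowr (u / p)
              * ennreal (\<psi> u powr u) / ennreal (\<epsilon> powr u)) \<le> ennreal \<delta>" for \<epsilon> \<delta>
  proof -
    have ZI: "Z \<omega> t - I t = Zc \<omega> t" for \<omega> t
      using n by (simp add: Z Zc sum_subtractf field_simps)
    have "0 \<le> a * (\<psi> p / \<psi> 1)"
      using a p psi_functionD(1)[OF psi, of p] psi_functionD(1)[OF psi, of 1] by simp
    hence "emeasure M {\<omega> \<in> space M. Y \<omega> > ennreal \<epsilon>}
        \<le> ennreal ((a * (\<psi> p / \<psi> 1)) powr u) * (\<integral>\<^sup>+ t. K t epowr p \<partial>\<nu>) epowr (u / p)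
              * ennreal (\<psi> u powr u) / ennreal (\<epsilon> powr u)" if "1 \<le> u" for u
      using psi_enorm_tail_bound[OF psi Y_meas norm \<open>0 < \<epsilon>\<close> that]
      by (simp only: epowr_mult epowr_ennreal Lp_enorm_def epowr_epowr) simp
    hence "emeasure M {\<omega> \<in> space M. Y \<omega> > ennreal \<epsilon>} \<le> ennreal \<delta>"
      by (intro order_trans[OF _ inf] INF_greatest) auto
    thus ?thesis
      using \<open>0 \<le> \<delta>\<close> by (simp add: approximates_in_Lp_def ZI Y_def M.emeasure_eq_measure)
  qed
  with norm show ?thesis
    unfolding Y_def Lp_enorm_def K_def a_def by blast
qed
end
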